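(* Assume the setting (H0) described in the context, and assume that $x^r_-$ is globally defined and bounded for some $r>0$. Let $\mathcal{K}\subset\mathbb{R}$ be any compact interval such that $X^s_+\in\mathcal{K}$ and $x^r_-(t)\in\mathcal{K}$ for all $t\in\mathbb{R}$. Then there exists $T_{r,\mathcal{K}}>0$ such that, if for every $\varepsilon>0$ there is $t_\varepsilon>T_{r,\mathcal{K}}$ for which $|x^r_-(t_\varepsilon)-X^s_+|<\varepsilon$, then $x^r_-$ end-point tracks the curve of quasi-static equilibria $X^s$, i.e. $x^r_-(t)\to X^s_+$ as $t\to\infty$.
   Context: Setting (H0). Let $\lambda_-<\lambda_+$ be real numbers and let $f\in C^2(\mathbb{R}\times\mathbb{R},\mathbb{R})$, $(x,\lambda)\mapsto f(x,\lambda)$, be bounded and such that the autonomous scalar problems $\dot x=f(x,\lambda)$, $\lambda\in[\lambda_-,\lambda_+]$, have existence and uniqueness of solutions and continuous dependence on parameter and initial data. A fixed point $X$ of $\dot x=f(x,\lambda)$ is hyperbolic if $\partial_xf(X,\lambda)\ne0$; it is then stable if $\partial_xf(X,\lambda)<0$ and unstable if $\partial_xf(X,\lambda)>0$. For every $\lambda\in[\lambda_-,\lambda_+]$, except at most a finite number of points in $(\lambda_-,\lambda_+)$, $\dot x=f(x,\lambda)$ has only hyperbolic fixed points. There is a stable hyperbolic fixed point $X^s_-$ of $\dot x=f(x,\lambda_-)$ which is continuously perturbed into stable hyperbolic fixed points, i.e. there is a continuous function $X^s:[\lambda_-,\lambda_+]\to\mathbb{R}$ with $X^s(\lambda_-)=X^s_-$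 such that $X^s(\lambda)$ is a stable hyperbolic fixed point of $\dot x=f(x,\lambda)$ for all $\lambda\in[\lambda_-,\lambda_+]$. Write $X^s_+:=X^s(\lambda_+)$. Let $\Lambda\in C^2(\mathbb{R},[\lambda_-,\lambda_+])$ be strictly increasing with $\lim_{t\to\pm\infty}\Lambda(t)=\lambda_\pm$ and $\lim_{t\to\pm\infty}\Lambda'(t)=0$. For $r>0$ consider \[ \dot x=f\big(x,\Lambda(rt)\big),\qquad x\in\mathbb{R},\ t\in\mathbb{R}. \qquad (E_r) \] With an abuse of notation $X^s(t):=X^s(\Lambda(t))$, so that $X^s(rt)=X^s(\Lambda(rt))$ is the curve of quasi-static equilibria. There is $p>0$ such that $\partial_xf(X^s(t),\Lambda(t))<-p<0$ for all $t\in\mathbb{R}$. For every $r>0$, $x^r_-:(-\infty,\beta^r_-)\to\mathbb{R}$ denotes the unique solution of $(E_r)$ with $\lim_{t\to-\infty}x^r_-(t)=X^s_-$ (it exists and is unique). $x^r_-$ end-point tracks the curve of quasi-static equilibria $X^s$ if it is defined on all of $\mathbb{R}$ and $\lim_{t\to+\infty}x^r_-(t)=X^s_+$. *)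

theory Defs
  imports "HOL-Analysis.Analysis"
begin

text \<open>Class $C^2$ on the whole space, by Frechet derivatives.\<close>

definition C2 :: "('a::real_normed_vector \<Rightarrow> 'b::real_normed_vector) \<Rightarrow> bool" where
  "C2 g \<longleftrightarrow> (\<exists>(Dg :: 'a \<Rightarrow> 'a \<Rightarrow>\<^sub>L 'b) (D2g :: 'a \<Rightarrow> 'a \<Rightarrow>\<^sub>L 'a \<Rightarrow>\<^sub>L 'b).
     (\<forall>z. (g has_derivative blinfun_apply (Dg z)) (at z)) \<and>
     (\<forall>z. (Dg has_derivative blinfun_apply (D2g z)) (at z)) \<and>
     continuous_on UNIV D2g)"

text \<open>\<open>x\<close> solves $\dot x = g(t,x)$ on \<open>S\<close>; only used for open \<open>S\<close>. Values of \<open>x\<close>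
  outside \<open>S\<close> are irrelevant.\<close>

definition solves_on :: "(real \<Rightarrow> real \<Rightarrow> real) \<Rightarrow> real set \<Rightarrow> (real \<Rightarrow> real) \<Rightarrow> bool" where
  "solves_on g S x \<longleftrightarrow> (\<forall>t\<in>S. (x has_real_derivative g t (x t)) (at t))"

definition unique_solutions :: "(real \<times> real \<Rightarrow> real) \<Rightarrow> real \<Rightarrow> bool" where
  "unique_solutions f l \<longleftrightarrow>
     (\<forall>a b t0 x y. t0 \<in> {a<..<b} \<longrightarrow>
        solves_on (\<lambda>t \<xi>. f (\<xi>, l)) {a<..<b} x \<longrightarrow>
        solves_on (\<lambda>t \<xi>. f (\<xi>, l)) {a<..<b} y \<longrightarrow>
        x t0 = y t0 \<longrightarrow> (\<forall>t\<in>{a<..<b}. x t = y t))"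

text \<open>Existence and continuous dependence on initial value and parameter, through a flow
  \<open>\<phi>\<close> depending jointly continuously on time, initial value and parameter. As \<open>f\<close> is bounded
  in the setting below, solutions cannot blow up, so the flow is global in time; as the
  problems are autonomous, it is enough to start at time \<open>0\<close>.\<close>

definition continuous_flow_exists :: "(real \<times> real \<Rightarrow> real) \<Rightarrow> real set \<Rightarrow> bool" where
  "continuous_flow_exists f L \<longleftrightarrow>
     (\<exists>\<phi> :: real \<times> real \<times> real \<Rightarrow> real.
        continuous_on (UNIV \<times> UNIV \<times> L) \<phi> \<and>
        (\<forall>\<xi>0. \<forall>l\<in>L. \<phi> (0, \<xi>0, l) = \<xi>0 \<and>
           solves_on (\<lambda>t \<xi>. f (\<xi>, l)) UNIV (\<lambda>t. \<phi> (t, \<xi>0, l))))"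

definition dx :: "(real \<times> real \<Rightarrow> real) \<Rightarrow> real \<Rightarrow> real \<Rightarrow> real" where
  "dx f X l = deriv (\<lambda>\<xi>. f (\<xi>, l)) X"

definition fixed_point :: "(real \<times> real \<Rightarrow> real) \<Rightarrow> real \<Rightarrow> real \<Rightarrow> bool" where
  "fixed_point f l X \<longleftrightarrow> f (X, l) = 0"

definition hyperbolic_fixed_point :: "(real \<times> real \<Rightarrow> real) \<Rightarrow> real \<Rightarrow> real \<Rightarrow> bool" where
  "hyperbolic_fixed_point f l X \<longleftrightarrow> fixed_point f l X \<and> dx f X l \<noteq> 0"

definition stable_hyperbolic_fixed_point :: "(real \<times> real \<Rightarrow> real) \<Rightarrow> real \<Rightarrow> real \<Rightarrow> bool" where
  "stable_hyperbolic_fixed_point f l X \<longleftrightarrow> hyperbolic_fixed_point f l X \<and> dx f X l < 0"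

text \<open>Setting (H0). The parameters \<open>lm\<close>, \<open>lp\<close> are $\lambda_-$, $\lambda_+$, and \<open>Xs\<close> is the curve
  $X^s$ as a function of the parameter $\lambda$, relevant on \<open>{lm..lp}\<close> only; in particular
  $X^s_\pm$ are \<open>Xs lm\<close>, \<open>Xs lp\<close>.\<close>

locale H0 =
  fixes f :: "real \<times> real \<Rightarrow> real"
    and lm lp :: real
    and Xs :: "real \<Rightarrow> real"
    and \<Lambda> :: "real \<Rightarrow> real"
  assumes lm_less_lp: "lm < lp"
    and f_C2: "C2 f"
    and f_bounded: "bounded (range f)"
    and unique: "\<And>l. l \<in> {lm..lp} \<Longrightarrow> unique_solutions f l"
    and flow: "continuous_flow_exists f {lm..lp}"
    and generic_hyperbolic:
      "\<exists>F. finite F \<and> F \<subseteq> {lm<..<lp} \<and>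
         (\<forall>l\<in>{lm..lp} - F. \<forall>X. fixed_point f l X \<longrightarrow> hyperbolic_fixed_point f l X)"
    and Xs_continuous: "continuous_on {lm..lp} Xs"
    and Xs_stable: "\<And>l. l \<in> {lm..lp} \<Longrightarrow> stable_hyperbolic_fixed_point f l (Xs l)"
    and \<Lambda>_C2: "C2 \<Lambda>"
    and \<Lambda>_range: "\<And>t. \<Lambda> t \<in> {lm..lp}"
    and \<Lambda>_strict_mono: "strict_mono \<Lambda>"
    and \<Lambda>_at_bot: "(\<Lambda> \<longlongrightarrow> lm) at_bot"
    and \<Lambda>_at_top: "(\<Lambda> \<longlongrightarrow> lp) at_top"
    and \<Lambda>'_at_bot: "(deriv \<Lambda> \<longlongrightarrow> 0) at_bot"
    and \<Lambda>'_at_top: "(deriv \<Lambda> \<longlongrightarrow> 0) at_top"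
    and uniformly_stable: "\<exists>p>0. \<forall>t. dx f (Xs (\<Lambda> t)) (\<Lambda> t) < - p"

text \<open>\<open>x\<close> is the solution $x^r_-$, with maximal interval of existence $(-\infty,\beta)$. Only the
  values of \<open>x\<close> on this interval matter, and on it they are determined by \<open>r\<close>.\<close>

definition is_x_minus ::
  "(real \<times> real \<Rightarrow> real) \<Rightarrow> real \<Rightarrow> (real \<Rightarrow> real) \<Rightarrow> (real \<Rightarrow> real) \<Rightarrow>
   real \<Rightarrow> ereal \<Rightarrow> (real \<Rightarrow> real) \<Rightarrow> bool" where
  "is_x_minus f lm Xs \<Lambda> r \<beta> x \<longleftrightarrow>
     - \<infinity> < \<beta> \<and>
     solves_on (\<lambda>t \<xi>. f (\<xi>, \<Lambda> (r * t))) {t. ereal t < \<beta>} x \<and>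
     (x \<longlongrightarrow> Xs lm) at_bot \<and>
     \<not> (\<exists>\<beta>' y. \<beta> < \<beta>' \<and>
          solves_on (\<lambda>t \<xi>. f (\<xi>, \<Lambda> (r * t))) {t. ereal t < \<beta>'} y \<and>
          (\<forall>t. ereal t < \<beta> \<longrightarrow> y t = x t))"

definition endpoint_tracks ::
  "real \<Rightarrow> (real \<Rightarrow> real) \<Rightarrow> ereal \<Rightarrow> (real \<Rightarrow> real) \<Rightarrow> bool" where
  "endpoint_tracks lp Xs \<beta> x \<longleftrightarrow> \<beta> = \<infinity> \<and> (x \<longlongrightarrow> Xs lp) at_top"

end

theory Submission
  imports Defs
begin

text \<open>
  Write \<open>c\<close> for \<open>Xs lp\<close>. At the limiting parameter \<open>lp\<close> the point \<open>c\<close> attracts every nearby point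
  at a rate proportional to its distance from \<open>c\<close>, and \<open>\<Lambda> (r * t)\<close> tends to \<open>lp\<close>. So there is a
  fixed radius \<open>\<delta> > 0\<close> such that, for every positive \<open>\<eta> \<le> \<delta>\<close>, the vector field of the nonautonomous problem
  points towards \<open>c\<close> with speed bounded away from zero on the whole shell
  \<open>\<eta> \<le> \<bar>\<xi> - c\<bar> \<le> \<delta>\<close> from some time \<open>\<tau> \<eta>\<close> on; this is
  \<open>stable_zero_attracts_shells\<close>. The time needed for the threshold is \<open>\<tau> \<delta>\<close>: a solution which is
  at distance less than \<open>\<delta>\<close> from \<open>c\<close> at some later time can never leave the \<open>\<delta>\<close>-neighbourhood, and
  then it must enter the \<open>\<eta>\<close>-neighbourhood for every smaller \<open>\<eta>\<close> after time \<open>\<tau> \<eta>\<close>, because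
  the squared distance to \<open>c\<close> would otherwise decrease linearly for ever. It cannot leave that smaller
  neighbourhood either, so it converges to \<open>c\<close>; this is
  \<open>solution_tendsto_if_shells_attract\<close>.
\<close>

text \<open>If \<open>v\<close> exceeded \<open>b\<close> at \<open>t1\<close>, then at the last earlier time with \<open>v \<le> b\<close> it would have to cross the level
  \<open>b\<close> upwards, against the sign of its derivative there.\<close>

lemma sublevel_forward_invariant:
  fixes v v' :: "real \<Rightarrow> real"
  assumes deriv: "\<And>t. t \<ge> t0 \<Longrightarrow> (v has_real_derivative v' t) (at t)"
    and inward: "\<And>t. t \<ge> t0 \<Longrightarrow> v t = b \<Longrightarrow> v' t < 0"
    and start: "v t0 \<le> b" and "t0 \<le> t1"
  shows "v t1 \<le> b"
proof (rule ccontr)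
  assume above: "\<not> v t1 \<le> b"
  define S where "S = {t \<in> {t0..t1}. v t \<le> b}"
  have "continuous_on {t0..t1} v"
    by (rule DERIV_continuous_on[where D = v'])
      (use deriv in \<open>auto intro: has_field_derivative_at_within\<close>)
  then have "closed S"
    unfolding S_def by (intro continuous_on_closed_Collect_le) auto
  moreover have "t0 \<in> S" and bdd: "bdd_above S"
    using start \<open>t0 \<le> t1\<close> by (auto simp: S_def)
  ultimately have "Sup S \<in> S"
    using closed_contains_Sup[of S] by auto
  define s where "s = Sup S"
  have s: "t0 \<le> s" "s < t1" "v s \<le> b"
    using \<open>Sup S \<in> S\<close> above by (auto simp: S_def s_def order_less_le)
  have after: "v t > b" if "s < t" "t \<le> t1" for t
  proof (rule ccontr)
    assume "\<not> v t > b"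
    then have "t \<in> S"
      using that s by (auto simp: S_def)
    then show False
      using cSup_upper[OF _ bdd] that by (force simp: s_def)
  qed
  have "v s = b"
  proof (rule ccontr)
    assume "v s \<noteq> b"
    then have "v s < b" using s by simp
    have "isCont v s"
      using deriv s by (auto intro: DERIV_isCont)
    then have "\<forall>\<^sub>F t in at_right s. v t < b"
      using \<open>v s < b\<close> order_tendstoD(2)[of v "v s" "at s" b]
      by (auto simp: isCont_def intro: filter_leD[OF at_le])
    moreover have "\<forall>\<^sub>F t in at_right s. v t > b"
      using after s by (auto simp: eventually_at_right intro!: exI[of _ t1])
    ultimately have "\<forall>\<^sub>F t in at_right s. False"
      by eventually_elim simp
    then show False by simp
  qed
  then have "v' s < 0" using inward s by simp
  then obtain d where d: "d > 0" "\<And>h. 0 < h \<Longrightarrow> h < d \<Longrightarrow> v (s + h) < v s"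
    using DERIV_neg_dec_right[OF deriv[OF s(1)]] by blast
  define h where "h = min (d / 2) (t1 - s)"
  have "0 < h" "h < d" "s + h \<le> t1"
    using d(1) s by (auto simp: h_def min_def)
  then show False
    using d(2)[of h] after[of "s + h"] \<open>v s = b\<close> by simp
qed

text \<open>Otherwise \<open>v\<close> would decrease at least linearly for ever and become negative.\<close>

lemma nonneg_reaches_sublevel:
  fixes v v' :: "real \<Rightarrow> real"
  assumes deriv: "\<And>t. t \<ge> t0 \<Longrightarrow> (v has_real_derivative v' t) (at t)"
    and decay: "\<And>t. t \<ge> t0 \<Longrightarrow> v t > b \<Longrightarrow> v' t \<le> - m"
    and "m > 0" and nonneg: "\<And>t. v t \<ge> 0"
  obtains t where "t \<ge> t0" "v t \<le> b"
proof (rule ccontr)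
  assume "\<not> thesis"
  then have above: "v t > b" if "t \<ge> t0" for t
    using that \<open>\<And>t. t0 \<le> t \<Longrightarrow> v t \<le> b \<Longrightarrow> thesis\<close> by force
  define t1 where "t1 = t0 + (v t0 + 1) / m"
  have "(v t0 + 1) / m > 0"
    using \<open>m > 0\<close> nonneg[of t0] by simp
  then have "t0 < t1" by (simp add: t1_def)
  then obtain z where z: "z > t0" "v t1 - v t0 = (t1 - t0) * v' z"
    using MVT2[of t0 t1 v v'] deriv by auto
  have "v' z \<le> - m"
    using decay above z(1) by simp
  then have "(t1 - t0) * v' z \<le> (t1 - t0) * (- m)"
    using \<open>t0 < t1\<close> by (intro mult_left_mono) auto
  also have "\<dots> = - (v t0 + 1)"
    using \<open>m > 0\<close> by (simp add: t1_def)
  finally show False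
    using z(2) nonneg[of t1] by simp
qed

text \<open>Both preceding lemmas are applied to the squared distance \<open>v\<close> from \<open>c\<close>, whose derivative along the
  solution is twice the inward quantity \<open>(\<xi> - c) * g t \<xi>\<close>. The hypothesis on shells serves two
  purposes: on the sphere of radius \<open>\<eta>\<close> it forbids escape, and in the shell between \<open>\<eta>\<close> and \<open>\<delta>\<close> it
  forces the solution inwards.\<close>

lemma solution_tendsto_if_shells_attract:
  fixes x :: "real \<Rightarrow> real" and g :: "real \<Rightarrow> real \<Rightarrow> real"
  assumes sol: "solves_on g UNIV x"
    and shells: "\<And>\<eta>. 0 < \<eta> \<Longrightarrow> \<eta> \<le> \<delta> \<Longrightarrow>
      m \<eta> > 0 \<and> (\<forall>t\<ge>\<tau> \<eta>. \<forall>\<xi>. \<eta> \<le> \<bar>\<xi> - c\<bar> \<longrightarrow> \<bar>\<xi> - c\<bar> \<le> \<delta> \<longrightarrow> (\<xi> - c) * g t \<xi> \<le> - m \<eta>)"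
    and "\<delta> > 0" and "t0 \<ge> \<tau> \<delta>" and near: "\<bar>x t0 - c\<bar> \<le> \<delta>"
  shows "(x \<longlongrightarrow> c) at_top"
proof -
  define v where "v t = (x t - c)\<^sup>2" for t
  define v' where "v' t = 2 * ((x t - c) * g t (x t))" for t
  have deriv: "(v has_real_derivative v' t) (at t)" for t
    using sol unfolding v_def v'_def solves_on_def
    by (auto intro!: derivative_eq_intros)
  have level: "v t \<le> \<eta>\<^sup>2 \<longleftrightarrow> \<bar>x t - c\<bar> \<le> \<eta>" if "\<eta> > 0" for t \<eta>
    using that abs_le_square_iff[of "x t - c" \<eta>] by (simp add: v_def)
  have inward: "v' t \<le> - (2 * m \<eta>)"
    if "0 < \<eta>" "\<eta> \<le> \<delta>" "t \<ge> \<tau> \<eta>" "\<eta> \<le> \<bar>x t - c\<bar>" "\<bar>x t - c\<bar> \<le> \<delta>" for t \<eta>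
    using shells[OF that(1,2)] that(3-5) by (force simp: v'_def)
  have trapped: "\<bar>x t - c\<bar> \<le> \<eta>"
    if \<eta>: "0 < \<eta>" "\<eta> \<le> \<delta>" and s: "s \<ge> \<tau> \<eta>" "\<bar>x s - c\<bar> \<le> \<eta>" "s \<le> t" for s t \<eta>
  proof -
    have "v t \<le> \<eta>\<^sup>2"
    proof (rule sublevel_forward_invariant[OF deriv])
      fix u assume "s \<le> u" "v u = \<eta>\<^sup>2"
      moreover have "\<bar>x u - c\<bar> = \<eta>"
        using \<open>v u = \<eta>\<^sup>2\<close> \<eta> by (auto simp: v_def power2_eq_iff)
      ultimately show "v' u < 0"
        using inward[OF \<eta>, of u] shells[OF \<eta>] s \<eta> by force
    qed (use s level[OF \<eta>(1)] in auto)
    then show ?thesis using level[OF \<eta>(1)] by simp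
  qed
  have in_ball: "\<bar>x t - c\<bar> \<le> \<delta>" if "t \<ge> t0" for t
    using trapped[of \<delta> t0 t] that assms by auto
  show ?thesis
  proof (rule tendstoI)
    fix e :: real assume "e > 0"
    define \<eta> where "\<eta> = min (e / 2) \<delta>"
    have \<eta>: "0 < \<eta>" "\<eta> \<le> \<delta>" "\<eta> < e"
      using \<open>e > 0\<close> \<open>\<delta> > 0\<close> by (auto simp: \<eta>_def min_def)
    obtain s where s: "s \<ge> max t0 (\<tau> \<eta>)" "v s \<le> \<eta>\<^sup>2"
    proof (rule nonneg_reaches_sublevel[OF deriv])
      fix t assume t: "max t0 (\<tau> \<eta>) \<le> t" "\<eta>\<^sup>2 < v t"
      then have "\<eta> < \<bar>x t - c\<bar>"
        using level[OF \<eta>(1), of t] by simp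
      then show "v' t \<le> - (2 * m \<eta>)"
        using inward[OF \<eta>(1,2), of t] in_ball[of t] t by simp
    next
      show "2 * m \<eta> > 0" using shells[OF \<eta>(1,2)] by simp
    qed (auto simp: v_def)
    have "dist (x t) c < e" if "t \<ge> s" for t
      using trapped[OF \<eta>(1,2), of s t] s level[OF \<eta>(1)] \<eta>(3) that by (simp add: dist_real_def)
    then show "\<forall>\<^sub>F t in at_top. dist (x t) c < e"
      by (auto simp: eventually_at_top_linorder)
  qed
qed

lemma C2_imp_differentiable:
  assumes "C2 g"
  shows "g differentiable (at z)"
  using assms unfolding C2_def differentiable_def by blast

text \<open>The radius comes from the derivative at \<open>l\<close>: there \<open>f (\<xi>, l)\<close> lies between half and three halves of
  its linearisation. Only afterwards is the shell fixed: passing from \<open>l\<close> to a nearby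
  parameter costs an arbitrarily small uniform error, which on the shell of inner radius \<open>\<eta>\<close> may be at most
  half of the available drift \<open>a * \<eta> / 2\<close>.\<close>

lemma stable_zero_attracts_shells:
  fixes f :: "real \<times> real \<Rightarrow> real" and \<mu> :: "real \<Rightarrow> real"
  assumes cont: "continuous_on UNIV f"
    and deriv: "((\<lambda>\<xi>. f (\<xi>, l)) has_real_derivative - a) (at c)"
    and "a > 0" and zero: "f (c, l) = 0"
    and \<mu>: "(\<mu> \<longlongrightarrow> l) at_top"
  obtains \<delta> m \<tau> where "\<delta> > 0"
    and "\<And>\<eta>. 0 < \<eta> \<Longrightarrow> \<eta> \<le> \<delta> \<Longrightarrow>
      m \<eta> > 0 \<and> (\<forall>t\<ge>\<tau> \<eta>. \<forall>\<xi>. \<eta> \<le> \<bar>\<xi> - c\<bar> \<longrightarrow> \<bar>\<xi> - c\<bar> \<le> \<delta> \<longrightarrow>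
        (\<xi> - c) * f (\<xi>, \<mu> t) \<le> - m \<eta>)"
proof -
  have "((\<lambda>\<xi>. f (\<xi>, l)) has_derivative ((*) (- a))) (at c)"
    using deriv unfolding has_field_derivative_def .
  then obtain d where d: "d > 0"
    "\<And>\<xi>. \<bar>\<xi> - c\<bar> < d \<Longrightarrow> \<bar>f (\<xi>, l) - f (c, l) - (- a * (\<xi> - c))\<bar> \<le> a / 2 * \<bar>\<xi> - c\<bar>"
    using \<open>a > 0\<close> unfolding has_derivative_at_alt by (metis half_gt_zero real_norm_def)
  define \<delta> where "\<delta> = d / 2"
  have "\<delta> > 0" using d by (simp add: \<delta>_def)
  have inward: "u * w \<le> - (a / 2 * \<bar>u\<bar> * \<bar>u\<bar>)" if "\<bar>w + a * u\<bar> \<le> a / 2 * \<bar>u\<bar>" for u w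
  proof -
    have "\<bar>u\<bar> * \<bar>w + a * u\<bar> \<le> \<bar>u\<bar> * (a / 2 * \<bar>u\<bar>)"
      using that by (intro mult_left_mono) auto
    then have "u * (w + a * u) \<le> \<bar>u\<bar> * (a / 2 * \<bar>u\<bar>)"
      by (metis abs_ge_self abs_mult order_trans)
    also have "\<dots> = a / 2 * u\<^sup>2"
      by (simp add: power2_eq_square)
    finally show ?thesis
      by (simp add: power2_eq_square distrib_left mult.left_commute)
  qed
  have drift: "(\<xi> - c) * f (\<xi>, l) \<le> - (a / 2 * \<bar>\<xi> - c\<bar> * \<bar>\<xi> - c\<bar>)" if "\<bar>\<xi> - c\<bar> \<le> \<delta>" for \<xi>
    by (rule inward) (use d(2)[of \<xi>] that d(1) zero in \<open>simp add: \<delta>_def\<close>)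
  have "compact (cball c \<delta> \<times> cball l 1)"
    by (intro compact_Times compact_cball)
  then have uc: "uniformly_continuous_on (cball c \<delta> \<times> cball l 1) f"
    using compact_uniformly_continuous cont continuous_on_subset by blast
  have shell: "\<exists>T. \<forall>t\<ge>T. \<forall>\<xi>. \<eta> \<le> \<bar>\<xi> - c\<bar> \<longrightarrow> \<bar>\<xi> - c\<bar> \<le> \<delta> \<longrightarrow>
      (\<xi> - c) * f (\<xi>, \<mu> t) \<le> - (a * \<eta> / 4 * \<eta>)" if "0 < \<eta>" for \<eta>
  proof -
    have "a * \<eta> / 4 > 0" using that \<open>a > 0\<close> by simp
    then obtain e where e: "e > 0"
      "\<And>z z'. z \<in> cball c \<delta> \<times> cball l 1 \<Longrightarrow> z' \<in> cball c \<delta> \<times> cball l 1 \<Longrightarrow>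
        dist z' z < e \<Longrightarrow> dist (f z') (f z) < a * \<eta> / 4"
      using uc unfolding uniformly_continuous_on_def by metis
    have "\<forall>\<^sub>F t in at_top. dist (\<mu> t) l < min e 1"
      using \<mu> e(1) by (intro tendstoD) auto
    then obtain T where T: "\<And>t. t \<ge> T \<Longrightarrow> dist (\<mu> t) l < min e 1"
      by (auto simp: eventually_at_top_linorder)
    have "(\<xi> - c) * f (\<xi>, \<mu> t) \<le> - (a * \<eta> / 4 * \<eta>)"
      if t: "t \<ge> T" and \<xi>: "\<eta> \<le> \<bar>\<xi> - c\<bar>" "\<bar>\<xi> - c\<bar> \<le> \<delta>" for t \<xi>
    proof -
      let ?\<rho> = "\<bar>\<xi> - c\<bar>"
      have "\<bar>f (\<xi>, \<mu> t) - f (\<xi>, l)\<bar> < a * \<eta> / 4"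
        using e(2)[of "(\<xi>, l)" "(\<xi>, \<mu> t)"] T[OF t] \<xi>
        by (auto simp: dist_Pair_Pair dist_commute dist_real_def abs_minus_commute)
      then have "\<bar>(\<xi> - c) * (f (\<xi>, \<mu> t) - f (\<xi>, l))\<bar> \<le> ?\<rho> * (a * \<eta> / 4)"
        unfolding abs_mult by (intro mult_left_mono) auto
      then have "(\<xi> - c) * (f (\<xi>, \<mu> t) - f (\<xi>, l)) \<le> ?\<rho> * (a * \<eta> / 4)"
        by (rule abs_le_D1)
      then have "(\<xi> - c) * f (\<xi>, \<mu> t) \<le> ?\<rho> * (a * \<eta> / 4) - a / 2 * ?\<rho> * ?\<rho>"
        using drift[OF \<xi>(2)] unfolding right_diff_distrib[of "\<xi> - c"] by simp
      also have "\<dots> \<le> ?\<rho> * (a * \<eta> / 4) - a / 2 * ?\<rho> * \<eta>"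
        using \<xi> \<open>a > 0\<close> by (intro diff_left_mono mult_left_mono) auto
      also have "\<dots> = - (a * \<eta> / 4 * ?\<rho>)" by (simp add: field_simps)
      also have "\<dots> \<le> - (a * \<eta> / 4 * \<eta>)"
        using \<xi> \<open>a * \<eta> / 4 > 0\<close> by (intro le_imp_neg_le mult_left_mono) auto
      finally show ?thesis .
    qed
    then show ?thesis by blast
  qed
  then obtain \<tau> where \<tau>: "\<And>\<eta>. 0 < \<eta> \<Longrightarrow> \<forall>t\<ge>\<tau> \<eta>. \<forall>\<xi>. \<eta> \<le> \<bar>\<xi> - c\<bar> \<longrightarrow> \<bar>\<xi> - c\<bar> \<le> \<delta> \<longrightarrow>
      (\<xi> - c) * f (\<xi>, \<mu> t) \<le> - (a * \<eta> / 4 * \<eta>)"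
    by metis
  show thesis
    by (rule that[of \<delta> "\<lambda>\<eta>. a * \<eta> / 4 * \<eta>" \<tau>]) (use \<open>\<delta> > 0\<close> \<open>a > 0\<close> \<tau> in auto)
qed

theorem proposition3p3:
  fixes f :: "real \<times> real \<Rightarrow> real" and lm lp :: real
    and Xs \<Lambda> :: "real \<Rightarrow> real"
    and r :: real and \<beta> :: ereal and x :: "real \<Rightarrow> real"
    and K :: "real set"
  assumes "H0 f lm lp Xs \<Lambda>"
    and "r > 0"
    and "is_x_minus f lm Xs \<Lambda> r \<beta> x"
    and "\<beta> = \<infinity>"
    and "bounded (range x)"
    and "compact K" and "is_interval K"
    and "Xs lp \<in> K"
    and "\<forall>t. x t \<in> K"
  shows "\<exists>T>0. (\<forall>\<epsilon>>0. \<exists>t>T. \<bar>x t - Xs lp\<bar> < \<epsilon>) \<longrightarrow> endpoint_tracks lp Xs \<beta> x"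
proof -
  interpret H0 f lm lp Xs \<Lambda> by fact
  have sol: "solves_on (\<lambda>t \<xi>. f (\<xi>, \<Lambda> (r * t))) UNIV x"
    using assms(3,4) by (simp add: is_x_minus_def)
  have cont: "continuous_on UNIV f"
    using C2_imp_differentiable[OF f_C2]
    by (auto intro!: differentiable_imp_continuous_on simp: differentiable_on_def)
  have stable: "f (Xs lp, lp) = 0" "dx f (Xs lp) lp < 0"
    using Xs_stable[of lp] lm_less_lp
    by (auto simp: stable_hyperbolic_fixed_point_def hyperbolic_fixed_point_def fixed_point_def)
  have "(f \<circ> (\<lambda>\<xi>. (\<xi>, lp))) differentiable (at (Xs lp))"
    by (rule differentiable_chain_at[OF _ C2_imp_differentiable[OF f_C2]])
      (auto simp: differentiable_def intro!: derivative_eq_intros exI)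
  then have "(\<lambda>\<xi>. f (\<xi>, lp)) field_differentiable (at (Xs lp))"
    by (auto simp: o_def real_differentiable_def field_differentiable_def)
  then have deriv: "((\<lambda>\<xi>. f (\<xi>, lp)) has_real_derivative - (- dx f (Xs lp) lp)) (at (Xs lp))"
    by (simp add: dx_def field_differentiable_derivI)
  have "filterlim (\<lambda>t. r * t) at_top at_top"
    by (rule filterlim_tendsto_pos_mult_at_top[OF tendsto_const \<open>r > 0\<close> filterlim_ident])
  then have lim: "((\<lambda>t. \<Lambda> (r * t)) \<longlongrightarrow> lp) at_top"
    by (rule filterlim_compose[OF \<Lambda>_at_top])
  obtain \<delta> m \<tau> where "\<delta> > 0" and shells: "\<And>\<eta>. 0 < \<eta> \<Longrightarrow> \<eta> \<le> \<delta> \<Longrightarrow>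
      m \<eta> > 0 \<and> (\<forall>t\<ge>\<tau> \<eta>. \<forall>\<xi>. \<eta> \<le> \<bar>\<xi> - Xs lp\<bar> \<longrightarrow> \<bar>\<xi> - Xs lp\<bar> \<le> \<delta> \<longrightarrow>
        (\<xi> - Xs lp) * f (\<xi>, \<Lambda> (r * t)) \<le> - m \<eta>)"
    by (rule stable_zero_attracts_shells[OF cont deriv _ stable(1) lim]) (use stable(2) in simp, blast)
  show ?thesis
  proof (intro exI conjI impI)
    show "max 1 (\<tau> \<delta>) > 0" by simp
  next
    assume "\<forall>\<epsilon>>0. \<exists>t>max 1 (\<tau> \<delta>). \<bar>x t - Xs lp\<bar> < \<epsilon>"
    then obtain t0 where "t0 > max 1 (\<tau> \<delta>)" "\<bar>x t0 - Xs lp\<bar> < \<delta>"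
      using \<open>\<delta> > 0\<close> by blast
    then have "(x \<longlongrightarrow> Xs lp) at_top"
      using solution_tendsto_if_shells_attract[OF sol shells \<open>\<delta> > 0\<close>, of t0] by simp
    then show "endpoint_tracks lp Xs \<beta> x"
      using \<open>\<beta> = \<infinity>\<close> by (simp add: endpoint_tracks_def)
  qed
qed

end
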